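(* Let $d\ge 1$, let $G$ be the symmetric group on $\{1,\ldots,d\}$, and let $\mathcal{A}=C^*(G)$ be the group $C^*$-algebra of $G$, i.e. the set of maps $G\to\mathbb{C}$ with product $(a\cdot b)(g)=\sum_{k\in G}a(k)\,b(k^{-1}g)$. Let $H\ge 1$ and let $N_0,\ldots,N_H\ge 1$ be integers. For $i=1,\ldots,H$ let $W_i\in\mathcal{A}^{N_i\times N_{i-1}}$ be a matrix with entries in $\mathcal{A}$, acting as a map $W_i:\mathcal{A}^{N_{i-1}}\to\mathcal{A}^{N_i}$ by left matrix multiplication, and let $\sigma_i:\mathcal{A}^{N_i}\to\mathcal{A}^{N_i}$ be an activation function applied elementwise over $G$, that is, $\sigma_i(x)(g)=\tilde\sigma_i(x(g))$ for all $x\in\mathcal{A}^{N_i}$ and $g\in G$, for some map $\tilde\sigma_i:\mathbb{C}^{N_i}\to\mathbb{C}^{N_i}$. Let $f=\sigma_H\circ W_H\circ\cdots\circ\sigma_1\circ W_1:\mathcal{A}^{N_0}\to\mathcal{A}^{N_H}$. Then $f$ is permutation equivariant: for every $x\in\mathcal{A}^{N_0}$ and every $h\in G$, if $x_h\in\mathcal{A}^{N_0}$ is defined by $x_h(g)=x(gh)$ for $g\in G$, then $f(x_h)(g)=f(x)(gh)$ for all $g\in G$.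
   Context: For a positive integer $N$, an element $x=(x_1,\ldots,x_N)\in\mathcal{A}^N$ is identified with the $\mathbb{C}^N$-valued map on $G$ given by $x(g)=(x_1(g),\ldots,x_N(g))$. Addition in $\mathcal{A}$ is pointwise. For $W=(w_{k,l})\in\mathcal{A}^{M\times N}$ and $x\in\mathcal{A}^N$, the vector $Wx\in\mathcal{A}^M$ has $k$-th entry $\sum_{l=1}^N w_{k,l}\cdot x_l$, where $\cdot$ is the convolution product of $C^*(G)$. The network has no bias terms. *)

theory Defs
  imports "HOL-Algebra.Sym_Groups" "Jordan_Normal_Form.Matrix"
begin

text \<open>Maps on \<open>G\<close> are represented by extensional functions, so that two elements of the algebra are
  equal iff they agree on \<open>carrier G\<close>.\<close>

definition group_algebra :: "('g, 'm) monoid_scheme \<Rightarrow> ('g \<Rightarrow> complex) ring" where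
  "group_algebra G =
    \<lparr>carrier = carrier G \<rightarrow>\<^sub>E UNIV,
     mult = (\<lambda>a b. \<lambda>g\<in>carrier G. \<Sum>k\<in>carrier G. a k * b (inv\<^bsub>G\<^esub> k \<otimes>\<^bsub>G\<^esub> g)),
     one = (\<lambda>g\<in>carrier G. if g = \<one>\<^bsub>G\<^esub> then 1 else 0),
     zero = (\<lambda>g\<in>carrier G. 0),
     add = (\<lambda>a b. \<lambda>g\<in>carrier G. a g + b g)\<rparr>"

text \<open>The entries of vectors and matrices below lie in a carrier-based ring, so the type-class
  operation \<open>(*\<^sub>v)\<close> does not apply. Indices start at \<open>0\<close>.\<close>

definition vec_over :: "('a, 'm) ring_scheme \<Rightarrow> nat \<Rightarrow> 'a vec set" where
  "vec_over R n = {x \<in> carrier_vec n. \<forall>l<n. x $ l \<in> carrier R}"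

definition mat_over :: "('a, 'm) ring_scheme \<Rightarrow> nat \<Rightarrow> nat \<Rightarrow> 'a mat set" where
  "mat_over R m n = {W \<in> carrier_mat m n. \<forall>k<m. \<forall>l<n. W $$ (k, l) \<in> carrier R}"

definition mat_vec_over :: "('a, 'm) ring_scheme \<Rightarrow> 'a mat \<Rightarrow> 'a vec \<Rightarrow> 'a vec" where
  "mat_vec_over R W x =
    vec (dim_row W) (\<lambda>k. \<Oplus>\<^bsub>R\<^esub>l\<in>{..<dim_col W}. W $$ (k, l) \<otimes>\<^bsub>R\<^esub> x $ l)"

definition eval_at :: "('g \<Rightarrow> complex) vec \<Rightarrow> 'g \<Rightarrow> complex vec" where
  "eval_at x g = map_vec (\<lambda>a. a g) x"

definition right_translate ::
    "('g, 'm) monoid_scheme \<Rightarrow> 'g \<Rightarrow> ('g \<Rightarrow> complex) vec \<Rightarrow> ('g \<Rightarrow> complex) vec" where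
  "right_translate G h x = map_vec (\<lambda>a. \<lambda>g\<in>carrier G. a (g \<otimes>\<^bsub>G\<^esub> h)) x"

definition elementwise_activation ::
    "('g, 'm) monoid_scheme \<Rightarrow> nat \<Rightarrow> (('g \<Rightarrow> complex) vec \<Rightarrow> ('g \<Rightarrow> complex) vec) \<Rightarrow> bool" where
  "elementwise_activation G n \<sigma> \<longleftrightarrow>
    \<sigma> \<in> vec_over (group_algebra G) n \<rightarrow> vec_over (group_algebra G) n \<and>
    (\<exists>\<sigma>' \<in> carrier_vec n \<rightarrow> carrier_vec n.
      \<forall>x\<in>vec_over (group_algebra G) n. \<forall>g\<in>carrier G. eval_at (\<sigma> x) g = \<sigma>' (eval_at x g))"

text \<open>\<open>network R W \<sigma> H\<close> is \<open>\<sigma> H \<circ> W H \<circ> \<dots> \<circ> \<sigma> 1 \<circ> W 1\<close>; the values \<open>W 0\<close> and \<open>\<sigma> 0\<close> are unused.\<close>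

primrec network :: "('a, 'm) ring_scheme \<Rightarrow> (nat \<Rightarrow> 'a mat) \<Rightarrow> (nat \<Rightarrow> 'a vec \<Rightarrow> 'a vec) \<Rightarrow>
    nat \<Rightarrow> 'a vec \<Rightarrow> 'a vec" where
  "network R W \<sigma> 0 = id"
| "network R W \<sigma> (Suc i) = \<sigma> (Suc i) \<circ> mat_vec_over R (W (Suc i)) \<circ> network R W \<sigma> i"

lemma finite_sym_group: "finite (carrier (sym_group d))"
  by (simp add: sym_group_def finite_permutations)

lemma abelian_group_group_algebra: "abelian_group (group_algebra G)"
proof (rule abelian_groupI)
  fix x assume "x \<in> carrier (group_algebra G)"
  then show "\<exists>y\<in>carrier (group_algebra G). y \<oplus>\<^bsub>group_algebra G\<^esub> x = \<zero>\<^bsub>group_algebra G\<^esub>"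
    by (intro bexI[of _ "\<lambda>g\<in>carrier G. - x g"]) (auto simp: group_algebra_def)
qed (auto simp: group_algebra_def fun_eq_iff restrict_def PiE_def extensional_def)

lemma ring_group_algebra:
  assumes "group G" and fin: "finite (carrier G)"
  shows "ring (group_algebra G)"
proof -
  interpret group G by fact
  have bij: "bij_betw (\<lambda>m. k \<otimes>\<^bsub>G\<^esub> m) (carrier G) (carrier G)" if "k \<in> carrier G" for k
    using that by (intro bij_betwI[where g = "\<lambda>m. inv\<^bsub>G\<^esub> k \<otimes>\<^bsub>G\<^esub> m"])
      (auto simp: m_assoc[symmetric])
  have delta: "inv\<^bsub>G\<^esub> k \<otimes>\<^bsub>G\<^esub> g = \<one>\<^bsub>G\<^esub> \<longleftrightarrow> k = g" if "k \<in> carrier G" "g \<in> carrier G" for k g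
    using that by (metis inv_closed inv_equality inv_inv l_inv)
  have mon: "Group.monoid (group_algebra G)"
  proof (rule monoidI)
    fix a b c
    assume "a \<in> carrier (group_algebra G)" "b \<in> carrier (group_algebra G)"
      "c \<in> carrier (group_algebra G)"
    have "(\<Sum>k\<in>carrier G. (\<Sum>j\<in>carrier G. a j * b (inv\<^bsub>G\<^esub> j \<otimes>\<^bsub>G\<^esub> k)) * c (inv\<^bsub>G\<^esub> k \<otimes>\<^bsub>G\<^esub> g))
        = (\<Sum>j\<in>carrier G. a j * (\<Sum>k\<in>carrier G. b k * c (inv\<^bsub>G\<^esub> k \<otimes>\<^bsub>G\<^esub> (inv\<^bsub>G\<^esub> j \<otimes>\<^bsub>G\<^esub> g))))"
      if g: "g \<in> carrier G" for g
    proof -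
      have "(\<Sum>k\<in>carrier G. (\<Sum>j\<in>carrier G. a j * b (inv\<^bsub>G\<^esub> j \<otimes>\<^bsub>G\<^esub> k)) * c (inv\<^bsub>G\<^esub> k \<otimes>\<^bsub>G\<^esub> g))
          = (\<Sum>j\<in>carrier G. a j * (\<Sum>k\<in>carrier G. b (inv\<^bsub>G\<^esub> j \<otimes>\<^bsub>G\<^esub> k) * c (inv\<^bsub>G\<^esub> k \<otimes>\<^bsub>G\<^esub> g)))"
        unfolding sum_distrib_left sum_distrib_right by (subst sum.swap) (simp add: mult.assoc)
      also have "\<dots> = (\<Sum>j\<in>carrier G. a j *
          (\<Sum>k\<in>carrier G. b k * c (inv\<^bsub>G\<^esub> k \<otimes>\<^bsub>G\<^esub> (inv\<^bsub>G\<^esub> j \<otimes>\<^bsub>G\<^esub> g))))"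
      proof (rule sum.cong[OF refl], rule arg_cong2[where f = "(*)", OF refl])
        fix j assume j: "j \<in> carrier G"
        have "(\<Sum>k\<in>carrier G. b (inv\<^bsub>G\<^esub> j \<otimes>\<^bsub>G\<^esub> k) * c (inv\<^bsub>G\<^esub> k \<otimes>\<^bsub>G\<^esub> g))
            = (\<Sum>k\<in>carrier G. b (inv\<^bsub>G\<^esub> j \<otimes>\<^bsub>G\<^esub> (j \<otimes>\<^bsub>G\<^esub> k)) * c (inv\<^bsub>G\<^esub> (j \<otimes>\<^bsub>G\<^esub> k) \<otimes>\<^bsub>G\<^esub> g))"
          by (rule sum.reindex_bij_betw[OF bij[OF j], symmetric])
        also have "\<dots> = (\<Sum>k\<in>carrier G. b k * c (inv\<^bsub>G\<^esub> k \<otimes>\<^bsub>G\<^esub> (inv\<^bsub>G\<^esub> j \<otimes>\<^bsub>G\<^esub> g)))"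
          using j g by (intro sum.cong refl) (simp add: m_assoc[symmetric] inv_mult_group)
        finally show "(\<Sum>k\<in>carrier G. b (inv\<^bsub>G\<^esub> j \<otimes>\<^bsub>G\<^esub> k) * c (inv\<^bsub>G\<^esub> k \<otimes>\<^bsub>G\<^esub> g))
            = (\<Sum>k\<in>carrier G. b k * c (inv\<^bsub>G\<^esub> k \<otimes>\<^bsub>G\<^esub> (inv\<^bsub>G\<^esub> j \<otimes>\<^bsub>G\<^esub> g)))" .
      qed
      finally show ?thesis .
    qed
    then show "(a \<otimes>\<^bsub>group_algebra G\<^esub> b) \<otimes>\<^bsub>group_algebra G\<^esub> c
        = a \<otimes>\<^bsub>group_algebra G\<^esub> (b \<otimes>\<^bsub>group_algebra G\<^esub> c)"
      by (auto simp: group_algebra_def fun_eq_iff restrict_def intro!: sum.cong)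
  next
    fix a assume a: "a \<in> carrier (group_algebra G)"
    show "\<one>\<^bsub>group_algebra G\<^esub> \<otimes>\<^bsub>group_algebra G\<^esub> a = a"
    proof
      fix g
      have "(\<Sum>k\<in>carrier G. (if k = \<one>\<^bsub>G\<^esub> then 1 else 0) * a (inv\<^bsub>G\<^esub> k \<otimes>\<^bsub>G\<^esub> g))
          = (\<Sum>k\<in>carrier G. if k = \<one>\<^bsub>G\<^esub> then a (inv\<^bsub>G\<^esub> k \<otimes>\<^bsub>G\<^esub> g) else 0)"
        by (intro sum.cong) auto
      then show "(\<one>\<^bsub>group_algebra G\<^esub> \<otimes>\<^bsub>group_algebra G\<^esub> a) g = a g"
        using a fin by (auto simp: group_algebra_def PiE_def extensional_def)
    qed
    show "a \<otimes>\<^bsub>group_algebra G\<^esub> \<one>\<^bsub>group_algebra G\<^esub> = a"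
    proof
      fix g
      have "(\<Sum>k\<in>carrier G. a k * (if inv\<^bsub>G\<^esub> k \<otimes>\<^bsub>G\<^esub> g = \<one>\<^bsub>G\<^esub> then 1 else 0))
          = (\<Sum>k\<in>carrier G. if k = g then a k else 0)" if "g \<in> carrier G"
        using that by (intro sum.cong) (auto simp: delta)
      then show "(a \<otimes>\<^bsub>group_algebra G\<^esub> \<one>\<^bsub>group_algebra G\<^esub>) g = a g"
        using a fin by (auto simp: group_algebra_def PiE_def extensional_def)
    qed
  qed (auto simp: group_algebra_def)
  show ?thesis
    by (intro ringI abelian_group_group_algebra mon)
      (auto simp: group_algebra_def fun_eq_iff restrict_def algebra_simps sum.distrib)
qed

lemma right_translate_closed:
  "x \<in> vec_over (group_algebra G) n \<Longrightarrow> right_translate G h x \<in> vec_over (group_algebra G) n"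
  by (auto simp: vec_over_def right_translate_def group_algebra_def)

lemma eval_at_right_translate:
  "g \<in> carrier G \<Longrightarrow> eval_at (right_translate G h x) g = eval_at x (g \<otimes>\<^bsub>G\<^esub> h)"
  by (auto simp: eval_at_def right_translate_def)

lemma mat_vec_over_closed:
  assumes "ring R" "W \<in> mat_over R m n" "x \<in> vec_over R n"
  shows "mat_vec_over R W x \<in> vec_over R m"
proof -
  interpret ring R by fact
  show ?thesis
    using assms(2,3) by (auto simp: mat_vec_over_def vec_over_def mat_over_def intro!: finsum_closed)
qed

lemma network_closed:
  assumes "ring (group_algebra G)"
    and "\<And>i. i \<in> {1..H} \<Longrightarrow> W i \<in> mat_over (group_algebra G) (N i) (N (i - 1))"
    and "\<And>i. i \<in> {1..H} \<Longrightarrow> elementwise_activation G (N i) (\<sigma> i)"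
    and "x \<in> vec_over (group_algebra G) (N 0)"
  shows "network (group_algebra G) W \<sigma> H x \<in> vec_over (group_algebra G) (N H)"
  using assms(2,3)
proof (induction H)
  case 0
  then show ?case using assms(4) by simp
next
  case (Suc H)
  have "network (group_algebra G) W \<sigma> H x \<in> vec_over (group_algebra G) (N H)"
    by (rule Suc.IH) (use Suc.prems in auto)
  moreover have "W (Suc H) \<in> mat_over (group_algebra G) (N (Suc H)) (N H)"
    using Suc.prems(1)[of "Suc H"] by simp
  ultimately have "mat_vec_over (group_algebra G) (W (Suc H)) (network (group_algebra G) W \<sigma> H x)
      \<in> vec_over (group_algebra G) (N (Suc H))"
    using mat_vec_over_closed[OF assms(1)] by blast
  then show ?case
    using Suc.prems(2)[of "Suc H"] by (auto simp: elementwise_activation_def)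
qed

end

theory Submission
  imports Defs
begin

text \<open>Left convolution by a fixed element commutes with right translation, because the formula for
  \<open>a \<cdot> b\<close> evaluates \<open>b\<close> only at left multiples of the argument. A pointwise activation commutes with
  any reparametrisation of the argument. Hence every layer is equivariant.\<close>

text \<open>Evaluation at a point of \<open>carrier G\<close> is additive and sends the zero of the
  algebra to 0, so it passes through finite sums. This turns the sums in \<open>mat_vec_over\<close>
  into sums of complex numbers.\<close>

lemma finsum_group_algebra_apply:
  assumes "finite I" "F \<in> I \<rightarrow> carrier (group_algebra G)" "g \<in> carrier G"
  shows "(\<Oplus>\<^bsub>group_algebra G\<^esub>l\<in>I. F l) g = (\<Sum>l\<in>I. F l g)"
proof -
  interpret abelian_group "group_algebra G" by (rule abelian_group_group_algebra)
  show ?thesis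
    using assms(1,2)
  proof (induction I rule: finite_induct)
    case empty
    have "\<zero>\<^bsub>group_algebra G\<^esub> g = 0" using assms(3) by (simp add: group_algebra_def)
    then show ?case by simp
  next
    case (insert l I)
    then have "(\<Oplus>\<^bsub>group_algebra G\<^esub>l\<in>insert l I. F l)
        = F l \<oplus>\<^bsub>group_algebra G\<^esub> (\<Oplus>\<^bsub>group_algebra G\<^esub>l\<in>I. F l)"
      by (intro finsum_insert) auto
    then have "(\<Oplus>\<^bsub>group_algebra G\<^esub>l\<in>insert l I. F l) g
        = F l g + (\<Oplus>\<^bsub>group_algebra G\<^esub>l\<in>I. F l) g"
      using assms(3) by (simp add: group_algebra_def)
    then show ?case using insert by simp
  qed
qed

lemma mult_group_algebra_closed:
  "a \<otimes>\<^bsub>group_algebra G\<^esub> b \<in> carrier (group_algebra G)"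
  by (simp add: group_algebra_def)

text \<open>Associativity, summand by summand: \<open>(inv k \<otimes> g) \<otimes> h = inv k
  \<otimes> (g \<otimes> h)\<close>. No reindexing of the sum over \<open>k\<close> takes
  place.\<close>

lemma mult_group_algebra_right_translate:
  assumes "group G" "g \<in> carrier G" "h \<in> carrier G"
  shows "(a \<otimes>\<^bsub>group_algebra G\<^esub> (\<lambda>g\<in>carrier G. b (g \<otimes>\<^bsub>G\<^esub> h))) g
    = (a \<otimes>\<^bsub>group_algebra G\<^esub> b) (g \<otimes>\<^bsub>G\<^esub> h)"
proof -
  interpret group G by fact
  show ?thesis
    using assms(2,3) by (simp add: group_algebra_def m_assoc)
qed

text \<open>Entries are extensional, so off \<open>carrier G\<close> they are all
  \<open>undefined\<close> and cannot differ. Equality of vectors thus reduces to evaluations, the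
  form in which activations are specified.\<close>

lemma vec_over_group_algebra_eqI:
  assumes x: "x \<in> vec_over (group_algebra G) n" and y: "y \<in> vec_over (group_algebra G) n"
    and eq: "\<And>g. g \<in> carrier G \<Longrightarrow> eval_at x g = eval_at y g"
  shows "x = y"
proof (rule eq_vecI)
  fix l assume "l < dim_vec y"
  then have l: "l < n" "l < dim_vec x" "l < dim_vec y" using x y by (auto simp: vec_over_def)
  have "x $ l \<in> carrier G \<rightarrow>\<^sub>E UNIV" "y $ l \<in> carrier G \<rightarrow>\<^sub>E UNIV"
    using x y l(1) by (auto simp: vec_over_def group_algebra_def)
  moreover have "(x $ l) g = (y $ l) g" if "g \<in> carrier G" for g
    \<comment> \<open>The \<open>l\<close>-th coordinate of \<open>eval_at x g\<close> is the value
      at \<open>g\<close> of the \<open>l\<close>-th entry of \<open>x\<close>.\<close>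
    using arg_cong[OF eq[OF that], of "\<lambda>v. v $ l"] l by (simp add: eval_at_def)
  ultimately show "x $ l = y $ l" by (rule PiE_ext)
qed (use x y in \<open>auto simp: vec_over_def\<close>)

lemma mat_vec_over_right_translate:
  assumes G: "group G" "finite (carrier G)"
    and W: "W \<in> mat_over (group_algebra G) m n"
    and x: "x \<in> vec_over (group_algebra G) n" and h: "h \<in> carrier G"
  shows "mat_vec_over (group_algebra G) W (right_translate G h x)
    = right_translate G h (mat_vec_over (group_algebra G) W x)"
proof (rule vec_over_group_algebra_eqI)
  interpret group G by fact
  note closed = mat_vec_over_closed[OF ring_group_algebra[OF G] W]
  show "mat_vec_over (group_algebra G) W (right_translate G h x) \<in> vec_over (group_algebra G) m"
    and "right_translate G h (mat_vec_over (group_algebra G) W x) \<in> vec_over (group_algebra G) m"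
    by (intro closed right_translate_closed x)+
  fix g assume g: "g \<in> carrier G"
  \<comment> \<open>These equations make every summation index \<open>l < dim_col W\<close> a valid
    index into \<open>x\<close>, where the translated entry can be read off.\<close>
  have "n = dim_col W" "n = dim_vec x" using W x by (auto simp: mat_over_def vec_over_def)
  then show "eval_at (mat_vec_over (group_algebra G) W (right_translate G h x)) g
      = eval_at (right_translate G h (mat_vec_over (group_algebra G) W x)) g"
    \<comment> \<open>The right side becomes an evaluation at \<open>g \<otimes> h\<close>. Both
      sides are then complex sums over \<open>l\<close> that agree term by term.\<close>
    unfolding eval_at_right_translate[OF g] using g h
    by (intro eq_vecI)
      (simp_all add: eval_at_def mat_vec_over_def right_translate_def finsum_group_algebra_apply
        mult_group_algebra_closed mult_group_algebra_right_translate[OF G(1)])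
qed

text \<open>At \<open>g\<close>, both sides equal
  \<open>\<sigma>' (eval_at x (g \<otimes> h))\<close>, since the same \<open>\<sigma>'\<close> acts
  at every point of the group.\<close>

lemma elementwise_activation_right_translate:
  assumes G: "group G" and \<sigma>: "elementwise_activation G n \<sigma>"
    and x: "x \<in> vec_over (group_algebra G) n" and h: "h \<in> carrier G"
  shows "\<sigma> (right_translate G h x) = right_translate G h (\<sigma> x)"
proof (rule vec_over_group_algebra_eqI)
  interpret group G by fact
  from \<sigma> obtain \<sigma>' where closed: "\<sigma> \<in> vec_over (group_algebra G) n \<rightarrow> vec_over (group_algebra G) n"
    and \<sigma>': "\<And>x g. x \<in> vec_over (group_algebra G) n \<Longrightarrow> g \<in> carrier G
      \<Longrightarrow> eval_at (\<sigma> x) g = \<sigma>' (eval_at x g)"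
    unfolding elementwise_activation_def by blast
  show "\<sigma> (right_translate G h x) \<in> vec_over (group_algebra G) n"
    and "right_translate G h (\<sigma> x) \<in> vec_over (group_algebra G) n"
    using closed x by (auto intro!: right_translate_closed funcset_mem[OF closed])
  fix g assume "g \<in> carrier G"
  then show "eval_at (\<sigma> (right_translate G h x)) g = eval_at (right_translate G h (\<sigma> x)) g"
    using x h by (simp add: \<sigma>' right_translate_closed eval_at_right_translate)
qed

text \<open>Induction on the number of layers. Equivariance takes the form of an equality of
  vectors, so that the result for the first layers can be substituted into the input of the next
  one.\<close>

theorem network_right_translate:
  assumes G: "group G" "finite (carrier G)"
    and "\<And>i. i \<in> {1..H} \<Longrightarrow> W i \<in> mat_over (group_algebra G) (N i) (N (i - 1))"
    and "\<And>i. i \<in> {1..H} \<Longrightarrow> elementwise_activation G (N i) (\<sigma> i)"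
    and x: "x \<in> vec_over (group_algebra G) (N 0)" and h: "h \<in> carrier G"
  shows "network (group_algebra G) W \<sigma> H (right_translate G h x)
    = right_translate G h (network (group_algebra G) W \<sigma> H x)"
  using assms(3,4)
proof (induction H)
  case 0
  then show ?case by simp
next
  case (Suc H)
  note ring = ring_group_algebra[OF G]
  have W: "W (Suc H) \<in> mat_over (group_algebra G) (N (Suc H)) (N H)"
    using Suc.prems(1)[of "Suc H"] by simp
  have \<sigma>: "elementwise_activation G (N (Suc H)) (\<sigma> (Suc H))"
    using Suc.prems(2)[of "Suc H"] by simp
  \<comment> \<open>The two layer lemmas require inputs with entries in the algebra, so the output
    of the first \<open>H\<close> layers must be known to lie there.\<close>
  have y: "network (group_algebra G) W \<sigma> H x \<in> vec_over (group_algebra G) (N H)"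
    by (rule network_closed[OF ring]) (use Suc.prems x in auto)
  have "network (group_algebra G) W \<sigma> H (right_translate G h x)
      = right_translate G h (network (group_algebra G) W \<sigma> H x)"
    by (rule Suc.IH) (use Suc.prems in auto)
  then show ?case
    by (simp add: mat_vec_over_right_translate[OF G W y h]
        elementwise_activation_right_translate[OF G(1) \<sigma> mat_vec_over_closed[OF ring W y] h])
qed

theorem mainTheorem1:
  fixes d H :: nat
    and G :: "(nat \<Rightarrow> nat) monoid"
    and A :: "((nat \<Rightarrow> nat) \<Rightarrow> complex) ring"
    and N :: "nat \<Rightarrow> nat"
    and W :: "nat \<Rightarrow> ((nat \<Rightarrow> nat) \<Rightarrow> complex) mat"
    and \<sigma> :: "nat \<Rightarrow> ((nat \<Rightarrow> nat) \<Rightarrow> complex) vec \<Rightarrow> ((nat \<Rightarrow> nat) \<Rightarrow> complex) vec"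
    and f :: "((nat \<Rightarrow> nat) \<Rightarrow> complex) vec \<Rightarrow> ((nat \<Rightarrow> nat) \<Rightarrow> complex) vec"
  assumes "d \<ge> 1"
    and "G = sym_group d"
    and "A = group_algebra G"
    and "H \<ge> 1"
    and "\<And>i. i \<le> H \<Longrightarrow> N i \<ge> 1"
    and "\<And>i. i \<in> {1..H} \<Longrightarrow> W i \<in> mat_over A (N i) (N (i - 1))"
    and "\<And>i. i \<in> {1..H} \<Longrightarrow> elementwise_activation G (N i) (\<sigma> i)"
    and "f = network A W \<sigma> H"
  shows "\<forall>x\<in>vec_over A (N 0). \<forall>h\<in>carrier G. \<forall>g\<in>carrier G.
    eval_at (f (right_translate G h x)) g = eval_at (f x) (g \<otimes>\<^bsub>G\<^esub> h)"
proof -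
  have G: "group G" "finite (carrier G)"
    using assms(2) by (simp_all add: sym_group_is_group finite_sym_group)
  \<comment> \<open>Evaluating this identity at \<open>g\<close> gives the pointwise claim.\<close>
  have "f (right_translate G h x) = right_translate G h (f x)"
    if "x \<in> vec_over A (N 0)" "h \<in> carrier G" for x h
    unfolding assms(3,8)
    by (rule network_right_translate[where N = N, OF G])
      (use assms(6,7) that in \<open>simp_all add: assms(3)\<close>)
  then show ?thesis by (simp add: eval_at_right_translate)
qed

end
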